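(* Every countable complemented modular lattice $L$ has a Banaschewski function with Boolean range; that is, there exists an antitone map $f\colon L\to L$ such that $x\oplus f(x)=1$ for each $x\in L$, and the range of $f$ is a Boolean sublattice of $L$.
   Context: "Countable" means at most countable. A lattice is complemented if it has a least element $0$ and a largest element $1$ and every $a\in L$ has a complement, i.e. an $x\in L$ with $a\wedge x=0$ and $a\vee x=1$. The notation $a\oplus b=c$ in a lattice with zero means $a\wedge b=0$ and $a\vee b=c$. A map $f$ between partially ordered sets is antitone if $x\leq y$ implies $f(y)\leq f(x)$. A Banaschewski function on a bounded lattice $L$ is an antitone map $f\colon L\to L$ such that $x\oplus f(x)=1$ for each $x\in L$. A Boolean sublattice of $L$ is a sublattice of $L$ that is, with the induced operations, a Boolean lattice. *)

theory Defs
  imports Main "HOL-Library.Countable_Set"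
begin

class modular_lattice = lattice +
  assumes modular_law: "x \<le> z \<Longrightarrow> sup x (inf y z) = inf (sup x y) z"

(* HOL-Library.Complemented_Lattices fixes a complementation operation as part of the
   structure; here complements are only required to exist. *)
class complemented_modular_lattice = modular_lattice + bounded_lattice +
  assumes ex_complement: "\<exists>x. inf a x = bot \<and> sup a x = top"

(* disjoint_sup a b c stands for "a \<oplus> b = c". *)
definition disjoint_sup :: "'a::bounded_lattice_bot \<Rightarrow> 'a \<Rightarrow> 'a \<Rightarrow> bool" where
  "disjoint_sup a b c \<longleftrightarrow> inf a b = bot \<and> sup a b = c"

definition banaschewski_function :: "('a::bounded_lattice \<Rightarrow> 'a) \<Rightarrow> bool" where
  "banaschewski_function f \<longleftrightarrow> antimono f \<and> (\<forall>x. disjoint_sup x (f x) top)"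

definition sublattice :: "'a::lattice set \<Rightarrow> bool" where
  "sublattice B \<longleftrightarrow> B \<noteq> {} \<and> (\<forall>x\<in>B. \<forall>y\<in>B. inf x y \<in> B \<and> sup x y \<in> B)"

(* The bounds z and u are those of B itself; they are not required to be the bounds of
   the ambient lattice, which need not have any. *)
definition boolean_sublattice :: "'a::lattice set \<Rightarrow> bool" where
  "boolean_sublattice B \<longleftrightarrow>
     sublattice B \<and>
     (\<forall>x\<in>B. \<forall>y\<in>B. \<forall>w\<in>B. inf x (sup y w) = sup (inf x y) (inf x w)) \<and>
     (\<exists>z\<in>B. \<exists>u\<in>B. (\<forall>x\<in>B. z \<le> x \<and> x \<le> u) \<and>
        (\<forall>x\<in>B. \<exists>y\<in>B. inf x y = z \<and> sup x y = u))"

end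

theory Submission
  imports Defs
begin

text \<open>
  The idea is best seen for the subspaces of a vector space with a basis
  \<open>e\<^sub>0, e\<^sub>1, \<dots>\<close>: the subspace \<open>x\<close> has as complement the span of those \<open>e\<^sub>i\<close> that do not lie
  in \<open>x\<close> plus the span of the earlier basis vectors. The larger \<open>x\<close> is, the fewer basis vectors
  are kept, and all these complements lie in the Boolean lattice generated by the basis.

  In a complemented modular lattice there need not be atoms, so a basis is replaced by finite
  ordered decompositions \<open>1 = p\<^sub>1 \<oplus> \<dots> \<oplus> p\<^sub>n\<close>, which get finer and finer. The greedy complement
  of \<open>x\<close> is the join of the blocks \<open>p\<^sub>i\<close> that are not below \<open>x \<squnion> p\<^sub>1 \<squnion> \<dots> \<squnion> p\<^bsub>i-1\<^esub>\<close>. It always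
  decreases when \<open>x\<close> increases (\<open>greedy_antimono\<close>). It is a complement of \<open>x\<close> as soon as
  each \<open>p\<^sub>i\<close> is either below \<open>x \<squnion> p\<^sub>1 \<squnion> \<dots> \<squnion> p\<^bsub>i-1\<^esub>\<close> or disjoint from it
  (\<open>sup_greedy\<close>, \<open>inf_greedy\<close>); such a decomposition is called adapted to \<open>x\<close>. Every decomposition
  becomes adapted to a given \<open>x\<close> after each block has been cut in two (\<open>adapted_split\<close>), and cutting
  blocks neither destroys adaptedness to another element nor changes its greedy complement
  (\<open>adapted_split_stable\<close>, \<open>greedy_split\<close>).

  If the lattice is countable, cutting successively for all its elements gives a sequence of
  decompositions such that every \<open>x\<close> has an adapted one from some stage on, with a greedy
  complement \<open>f x\<close> that does not depend on the stage. Two elements can be compared at a common stage,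
  so \<open>f\<close> is antitone. Finally, the joins of blocks of one decomposition form a Boolean lattice
  (\<open>boolean_sublattice_block_joins\<close>), and each such join is the greedy complement of the join of the
  other blocks (\<open>greedy_block_join\<close>), so the range of \<open>f\<close> is a directed union of Boolean lattices.
\<close>

section \<open>Independent lists of elements in a modular lattice\<close>

definition join :: "'a::bounded_lattice_bot list \<Rightarrow> 'a" where
  "join ps = foldr sup ps bot"

lemma join_simps [simp]:
  "join [] = bot"
  "join (p # ps) = sup p (join ps)"
  by (simp_all add: join_def)

lemma join_filter_le: "join (filter P ps) \<le> join ps"
  by (induction ps) (auto intro: le_supI2 sup_mono)

lemma sup_join_filter:
  "sup (join (filter P ps)) (join (filter Q ps)) = join (filter (\<lambda>p. P p \<or> Q p) ps)"
  by (induction ps) (auto simp: ac_simps)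

text \<open>
  The base \<open>c\<close> stands for the join of the entries already passed. Keeping it as a parameter makes
  independence, and the constructions below, amenable to induction from the head of the list.
\<close>
fun independent :: "'a::bounded_lattice_bot \<Rightarrow> 'a list \<Rightarrow> bool" where
  "independent c [] \<longleftrightarrow> True"
| "independent c (p # ps) \<longleftrightarrow> inf c p = bot \<and> independent (sup c p) ps"

text \<open>
  Disjointness is associative, as for independent subspaces: by modularity \<open>b\<close> is the meet of
  \<open>a \<squnion> b\<close> and \<open>b \<squnion> c\<close>, and \<open>a \<sqinter> (b \<squnion> c)\<close> lies below both.
\<close>
lemma disjoint_sup_shift:
  fixes a b c :: "'a::{modular_lattice,bounded_lattice_bot}"
  assumes "inf a b = bot" "inf (sup a b) c = bot"
  shows "inf a (sup b c) = bot"
proof -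
  have "inf (sup b c) (sup a b) = sup b (inf c (sup a b))"
    by (rule modular_law[symmetric]) simp
  also have "\<dots> = b"
    using assms(2) by (simp add: inf.commute)
  finally have "inf (sup b c) (sup a b) = b" .
  then have "inf a (sup b c) \<le> b"
    by (metis inf.commute inf_mono order_refl sup_ge1)
  then have "inf a (sup b c) \<le> inf a b"
    by simp
  then show ?thesis
    using assms(1) by (simp add: bot_unique)
qed

lemma independent_base_mono:
  "independent d ps \<Longrightarrow> c \<le> d \<Longrightarrow> independent c ps"
proof (induction ps arbitrary: c d)
  case (Cons p ps)
  have "inf c p \<le> inf d p" "sup c p \<le> sup d p"
    using Cons.prems(2) by (rule inf_mono sup_mono, simp)+
  then show ?case
    using Cons.IH[of "sup d p" "sup c p"] Cons.prems(1) by (metis independent.simps(2) bot_unique)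
qed simp

lemma independent_inf_join:
  fixes c :: "'a::{modular_lattice,bounded_lattice_bot}"
  shows "independent c ps \<Longrightarrow> inf c (join ps) = bot"
  by (induction ps arbitrary: c) (auto intro: disjoint_sup_shift)

lemma independent_inf_head:
  fixes c :: "'a::{modular_lattice,bounded_lattice_bot}"
  assumes "independent c (p # ps)"
  shows "inf p (sup c (join ps)) = bot"
  using assms independent_inf_join[of "sup c p" ps]
  by (intro disjoint_sup_shift) (auto simp: ac_simps)

text \<open>
  An independent list generates a distributive sublattice. If the head \<open>p\<close> belongs to only one of
  the two selections, the induction hypothesis for the base \<open>c \<squnion> p\<close> bounds the meet from above, and
  the modular law removes the superfluous \<open>p\<close>.
\<close>
lemma inf_sup_join_filter:
  fixes c :: "'a::{modular_lattice,bounded_lattice_bot}"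
  assumes "independent c ps"
  shows "inf (sup c (join (filter P ps))) (sup c (join (filter Q ps))) =
    sup c (join (filter (\<lambda>p. P p \<and> Q p) ps))"
  using assms
proof (induction ps arbitrary: c P Q)
  case (Cons p ps)
  let ?j = "\<lambda>R. join (filter R ps)"
  have ind: "independent (sup c p) ps" and ind': "independent c ps"
    using Cons.prems independent_base_mono[of "sup c p" ps c] by auto
  have one_sided: "inf (sup c (sup p (?j R))) (sup c (?j S)) = sup c (?j (\<lambda>p. R p \<and> S p))"
    for R S
  proof -
    let ?m = "sup c (?j (\<lambda>p. R p \<and> S p))"
    have m: "?m \<le> sup c (?j S)"
      using sup_join_filter[of "\<lambda>p. R p \<and> S p" ps S]
      by (metis (mono_tags, lifting) filter_cong sup.absorb_iff2 sup_ge1 sup_mono order_refl)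
    have "inf p (sup c (?j S)) \<le> inf p (sup c (join ps))"
      by (intro inf_mono sup_mono join_filter_le order_refl)
    then have p: "inf p (sup c (?j S)) = bot"
      using independent_inf_head[OF Cons.prems] by (simp add: bot_unique)
    have "sup c (?j S) \<le> sup (sup c p) (?j S)"
      by (simp add: le_supI1)
    then have "inf (sup c (sup p (?j R))) (sup c (?j S)) =
        inf (inf (sup (sup c p) (?j R)) (sup (sup c p) (?j S))) (sup c (?j S))"
      by (simp only: inf.assoc inf.absorb2 sup.assoc)
    also have "\<dots> = inf (sup ?m p) (sup c (?j S))"
      unfolding Cons.IH[OF ind] by (simp only: ac_simps)
    also have "\<dots> = sup ?m (inf p (sup c (?j S)))"
      by (rule modular_law[OF m, symmetric])
    finally show ?thesis
      by (simp add: p)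
  qed
  show ?case
    using Cons.IH[OF ind] Cons.IH[OF ind'] one_sided[of P Q] one_sided[of Q P]
    by (cases "P p"; cases "Q p")
       (simp_all add: sup.assoc inf.commute conj_commute)
qed simp

lemma inf_join_filter:
  fixes ps :: "'a::{modular_lattice,bounded_lattice_bot} list"
  assumes "independent bot ps"
  shows "inf (join (filter P ps)) (join (filter Q ps)) = join (filter (\<lambda>p. P p \<and> Q p) ps)"
  using inf_sup_join_filter[OF assms] by simp

definition block_joins :: "'a::bounded_lattice_bot list \<Rightarrow> 'a set" where
  "block_joins ps = range (\<lambda>P. join (filter P ps))"

lemma bot_in_block_joins: "bot \<in> block_joins ps"
  unfolding block_joins_def by (rule range_eqI[where x = "\<lambda>_. False"]) simp

lemma join_in_block_joins: "join ps \<in> block_joins ps"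
  unfolding block_joins_def by (rule range_eqI[where x = "\<lambda>_. True"]) simp

text \<open>
  For an independent list, selecting entries turns conjunction, disjunction and negation of
  predicates into meet, join and complement, so the laws are inherited from the predicates.
\<close>
lemma boolean_sublattice_block_joins:
  fixes ps :: "'a::{modular_lattice,bounded_lattice_bot} list"
  assumes ind: "independent bot ps"
  shows "boolean_sublattice (block_joins ps)"
  unfolding boolean_sublattice_def sublattice_def
proof (intro conjI ballI)
  show "block_joins ps \<noteq> {}"
    using bot_in_block_joins by blast
next
  fix x y assume "x \<in> block_joins ps" "y \<in> block_joins ps"
  then obtain P Q where "x = join (filter P ps)" "y = join (filter Q ps)"
    unfolding block_joins_def by blast
  then show "inf x y \<in> block_joins ps" "sup x y \<in> block_joins ps"
    unfolding block_joins_def by (auto simp: inf_join_filter[OF ind] sup_join_filter)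
next
  fix x y w assume "x \<in> block_joins ps" "y \<in> block_joins ps" "w \<in> block_joins ps"
  then obtain P Q R
    where "x = join (filter P ps)" "y = join (filter Q ps)" "w = join (filter R ps)"
    unfolding block_joins_def by blast
  then show "inf x (sup y w) = sup (inf x y) (inf x w)"
    by (simp add: inf_join_filter[OF ind] sup_join_filter conj_disj_distribL)
next
  have bounds: "bot \<le> x \<and> x \<le> join ps" if "x \<in> block_joins ps" for x
    using that join_filter_le unfolding block_joins_def by auto
  have compl: "\<exists>y\<in>block_joins ps. inf x y = bot \<and> sup x y = join ps"
    if x: "x \<in> block_joins ps" for x
  proof -
    obtain P where P: "x = join (filter P ps)"
      using x unfolding block_joins_def by blast
    have "join (filter (\<lambda>p. \<not> P p) ps) \<in> block_joins ps"
      unfolding block_joins_def by blast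
    then show ?thesis
      by (rule bexI[rotated]) (simp add: P inf_join_filter[OF ind] sup_join_filter)
  qed
  show "\<exists>z\<in>block_joins ps. \<exists>u\<in>block_joins ps. (\<forall>x\<in>block_joins ps. z \<le> x \<and> x \<le> u) \<and>
      (\<forall>x\<in>block_joins ps. \<exists>y\<in>block_joins ps. inf x y = z \<and> sup x y = u)"
    using bounds compl bot_in_block_joins join_in_block_joins by blast
qed

text \<open>
  Any three elements of a directed union already lie in one member; as all members share the bounds
  of the ambient lattice, complements taken in a member remain complements in the union.
\<close>
lemma boolean_sublattice_locally:
  fixes R :: "'a::bounded_lattice set"
  assumes local: "\<And>x y w. x \<in> R \<Longrightarrow> y \<in> R \<Longrightarrow> w \<in> R \<Longrightarrow>
      \<exists>B\<subseteq>R. boolean_sublattice B \<and> {x, y, w, bot, top} \<subseteq> B"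
    and "R \<noteq> {}"
  shows "boolean_sublattice R"
proof -
  have closed: "inf x y \<in> R \<and> sup x y \<in> R \<and> inf x (sup y w) = sup (inf x y) (inf x w) \<and>
      bot \<in> R \<and> top \<in> R \<and> (\<exists>v\<in>R. inf x v = bot \<and> sup x v = top)"
    if xyw: "x \<in> R" "y \<in> R" "w \<in> R" for x y w
  proof -
    obtain B where B: "B \<subseteq> R" "boolean_sublattice B" "{x, y, w, bot, top} \<subseteq> B"
      using local[OF xyw] by blast
    have "inf x y \<in> B \<and> sup x y \<in> B" "inf x (sup y w) = sup (inf x y) (inf x w)"
      using B(2,3) unfolding boolean_sublattice_def sublattice_def by auto
    moreover obtain z u where zu: "\<forall>x\<in>B. z \<le> x \<and> x \<le> u"
        "\<forall>x\<in>B. \<exists>y\<in>B. inf x y = z \<and> sup x y = u"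
      using B(2) unfolding boolean_sublattice_def by blast
    moreover have "z = bot" "u = top"
      using zu(1) B(3) by (auto simp: bot_unique top_unique)
    ultimately show ?thesis
      using B(1,3) by blast
  qed
  moreover obtain r where "r \<in> R"
    using assms(2) by blast
  ultimately have "bot \<in> R" "top \<in> R"
    by blast+
  then have "\<exists>z\<in>R. \<exists>u\<in>R. (\<forall>x\<in>R. z \<le> x \<and> x \<le> u) \<and>
      (\<forall>x\<in>R. \<exists>y\<in>R. inf x y = z \<and> sup x y = u)"
    using closed by (intro bexI[of _ bot] bexI[of _ top]) simp_all
  then show ?thesis
    unfolding boolean_sublattice_def sublattice_def using closed assms(2) by blast
qed

section \<open>Greedy complements along an independent list\<close>

text \<open>
  The first argument is the element \<open>x\<close> to be complemented, joined with the entries already passed.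
  Joining \<open>bot\<close> for an omitted entry makes it immaterial whether a null entry counts as kept.
\<close>
fun greedy :: "'a::bounded_lattice_bot \<Rightarrow> 'a list \<Rightarrow> 'a" where
  "greedy d [] = bot"
| "greedy d (p # ps) = sup (if p \<le> d then bot else p) (greedy (sup d p) ps)"

fun adapted :: "'a::bounded_lattice_bot \<Rightarrow> 'a list \<Rightarrow> bool" where
  "adapted d [] \<longleftrightarrow> True"
| "adapted d (p # ps) \<longleftrightarrow> (p \<le> d \<or> inf d p = bot) \<and> adapted (sup d p) ps"

lemma greedy_antimono: "d \<le> e \<Longrightarrow> greedy e ps \<le> greedy d ps"
proof (induction ps arbitrary: d e)
  case (Cons p ps)
  have "greedy (sup e p) ps \<le> greedy (sup d p) ps"
    using Cons.prems by (intro Cons.IH) (simp add: le_supI1)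
  moreover have "(if p \<le> e then bot else p) \<le> (if p \<le> d then bot else p)"
    using Cons.prems by (auto dest: order_trans)
  ultimately show ?case
    by (simp only: greedy.simps sup_mono)
qed simp

text \<open>An omitted entry is already below the part passed so far, hence contributes nothing.\<close>
lemma sup_greedy: "sup d (greedy d ps) = sup d (join ps)"
proof (induction ps arbitrary: d)
  case (Cons p ps)
  have "sup d (greedy d (p # ps)) = sup (sup d p) (greedy (sup d p) ps)"
    by (simp add: sup.absorb1 sup.assoc[symmetric])
  also have "\<dots> = sup d (join (p # ps))"
    by (simp only: Cons.IH join_simps sup.assoc)
  finally show ?case .
qed simp

lemma inf_greedy:
  fixes d :: "'a::{modular_lattice,bounded_lattice_bot}"
  shows "adapted d ps \<Longrightarrow> inf d (greedy d ps) = bot"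
proof (induction ps arbitrary: d)
  case (Cons p ps)
  then have IH: "inf (sup d p) (greedy (sup d p) ps) = bot"
    by simp
  show ?case
  proof (cases "p \<le> d")
    case True
    then show ?thesis
      using IH by (simp add: sup.absorb1)
  next
    case False
    then show ?thesis
      using IH Cons.prems by (simp add: disjoint_sup_shift)
  qed
qed simp

text \<open>
  A selection that depends on the position in the list is also given by a predicate on its entries:
  take the entries below the selected join.
\<close>
lemma greedy_in_block_joins: "greedy d ps \<in> block_joins ps"
proof -
  have "greedy d ps \<le> join (filter (\<lambda>p. p \<le> b) ps)" if "greedy d ps \<le> b" for b
    using that by (induction ps arbitrary: d) (auto intro: le_supI2 split: if_splits)
  moreover have "join (filter (\<lambda>p. p \<le> b) ps) \<le> b" for b
    by (induction ps) auto
  ultimately have "greedy d ps = join (filter (\<lambda>p. p \<le> greedy d ps) ps)"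
    by (simp add: order_antisym)
  then show ?thesis
    unfolding block_joins_def by (rule range_eqI[where x = "\<lambda>p. p \<le> greedy d ps"])
qed

text \<open>
  A block left out of the join is disjoint from everything before it and from all other blocks,
  so the greedy procedure keeps exactly those.
\<close>
lemma greedy_block_join:
  fixes c :: "'a::{modular_lattice,bounded_lattice_bot}"
  assumes "independent c ps" "d = sup c (join (filter (\<lambda>p. \<not> P p) ps))"
  shows "adapted d ps \<and> greedy d ps = join (filter P ps)"
  using assms(1) unfolding assms(2)
proof (induction ps arbitrary: c)
  case (Cons p ps)
  let ?j = "join (filter (\<lambda>p. \<not> P p) ps)"
  have IH: "adapted (sup (sup c p) ?j) ps" "greedy (sup (sup c p) ?j) ps = join (filter P ps)"
    using Cons by auto
  show ?case
  proof (cases "P p")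
    case True
    have "inf p (sup c ?j) \<le> inf p (sup c (join ps))"
      by (intro inf_mono sup_mono join_filter_le order_refl)
    then have "inf (sup c ?j) p = bot"
      using independent_inf_head[OF Cons.prems] by (simp add: bot_unique inf.commute)
    moreover from this have "p \<le> sup c ?j \<Longrightarrow> p = bot"
      by (simp add: inf.absorb2)
    moreover have "sup (sup c ?j) p = sup (sup c p) ?j"
      by (simp add: ac_simps)
    ultimately show ?thesis
      using True IH by auto
  next
    case False
    have "sup (sup c (sup p ?j)) p = sup (sup c p) ?j" "p \<le> sup c (sup p ?j)"
      by (simp_all add: ac_simps le_supI2)
    then show ?thesis
      using False IH by simp
  qed
qed simp

section \<open>Refining a decomposition to adapt it to an element\<close>

definition relative_complement :: "'a::bounded_lattice_bot \<Rightarrow> 'a \<Rightarrow> 'a" where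
  "relative_complement a b = (SOME r. disjoint_sup a r b)"

lemma relative_complement:
  fixes a b :: "'a::complemented_modular_lattice"
  assumes "a \<le> b"
  shows "inf a (relative_complement a b) = bot" "sup a (relative_complement a b) = b"
proof -
  obtain x where x: "inf a x = bot" "sup a x = top"
    using ex_complement by blast
  have "sup a (inf x b) = b"
    using modular_law[OF assms, of x] x(2) by simp
  moreover have "inf a (inf x b) = bot"
    using x(1) by (simp add: inf.assoc[symmetric])
  ultimately have "disjoint_sup a (inf x b) b"
    by (simp add: disjoint_sup_def)
  then have "disjoint_sup a (relative_complement a b) b"
    unfolding relative_complement_def by (rule someI)
  then show "inf a (relative_complement a b) = bot" "sup a (relative_complement a b) = b"
    by (simp_all add: disjoint_sup_def)
qed

fun split :: "'a::complemented_modular_lattice \<Rightarrow> 'a list \<Rightarrow> 'a list" where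
  "split d [] = []"
| "split d (p # ps) = inf d p # relative_complement (inf d p) p # split (sup d p) ps"

lemma split_parts:
  fixes d p :: "'a::complemented_modular_lattice"
  shows "inf (inf d p) (relative_complement (inf d p) p) = bot"
    and "sup (inf d p) (relative_complement (inf d p) p) = p"
  by (rule relative_complement; simp)+

lemma sup_split_parts:
  fixes c d p :: "'a::complemented_modular_lattice"
  shows "sup (sup c (inf d p)) (relative_complement (inf d p) p) = sup c p"
  by (simp only: sup.assoc split_parts)

lemma join_split: "join (split d ps) = join ps"
  by (induction ps arbitrary: d) (simp_all add: sup.assoc[symmetric] split_parts)

text \<open>
  This is the reason why both independence and adaptedness survive the cutting of a block into
  \<open>q\<close> and \<open>r\<close>; in both cases \<open>c\<close> is what precedes the block.
\<close>
lemma disjoint_parts: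
  fixes c q r :: "'a::{modular_lattice,bounded_lattice_bot}"
  assumes "inf c (sup q r) = bot" "inf q r = bot"
  shows "inf c q = bot" "inf (sup c q) r = bot"
proof -
  have "inf c q \<le> inf c (sup q r)"
    by (intro inf_mono) simp_all
  then show "inf c q = bot"
    using assms(1) by (simp add: bot_unique)
  have "inf r (sup q c) = bot"
    using assms by (intro disjoint_sup_shift) (simp_all add: ac_simps)
  then show "inf (sup c q) r = bot"
    by (simp add: ac_simps)
qed

lemma disjoint_split_parts:
  fixes c d p :: "'a::complemented_modular_lattice"
  assumes "inf c p = bot"
  shows "inf c (inf d p) = bot"
    and "inf (sup c (inf d p)) (relative_complement (inf d p) p) = bot"
  using disjoint_parts[of c "inf d p" "relative_complement (inf d p) p"] assms
  by (simp_all only: split_parts)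

lemma independent_split: "independent c ps \<Longrightarrow> independent c (split d ps)"
  by (induction ps arbitrary: c d) (simp_all add: disjoint_split_parts sup_split_parts)

text \<open>
  The first part of a block \<open>p\<close> is the largest part of \<open>p\<close> below \<open>d\<close>; what remains meets \<open>d\<close> inside
  that first part, hence trivially.
\<close>
lemma adapted_split: "adapted d (split d ps)"
proof (induction ps arbitrary: d)
  case (Cons p ps)
  let ?r = "relative_complement (inf d p) p"
  have "?r \<le> p"
    using split_parts(2)[of d p] by (metis sup_ge2)
  then have "inf d ?r \<le> inf (inf d p) ?r"
    by (simp add: le_infI2)
  then have "inf d ?r = bot"
    by (simp only: split_parts bot_unique)
  then show ?case
    using Cons.IH sup_split_parts[of d d p] by (simp add: sup.absorb1)
qed simp

lemma adapted_split_stable: "adapted d ps \<Longrightarrow> adapted d (split e ps)"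
proof (induction ps arbitrary: d e)
  case (Cons p ps)
  have "p \<le> d \<Longrightarrow> relative_complement (inf e p) p \<le> d"
    using split_parts(2)[of e p] by (metis le_sup_iff)
  then show ?case
    using Cons disjoint_split_parts[of d p e]
    by (auto simp: sup_split_parts intro: le_infI2 le_supI1)
qed simp

text \<open>
  Either both parts of a block are omitted or, up to null elements, both are kept.
\<close>
lemma greedy_split: "adapted d ps \<Longrightarrow> greedy d (split e ps) = greedy d ps"
proof (induction ps arbitrary: d e)
  case (Cons p ps)
  let ?q = "inf e p" and ?r = "relative_complement (inf e p) p"
  have "greedy (sup (sup d ?q) ?r) (split (sup e p) ps) = greedy (sup d p) ps"
    using Cons by (simp add: sup_split_parts)
  moreover have "sup (if ?q \<le> d then bot else ?q) (if ?r \<le> sup d ?q then bot else ?r) =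
      (if p \<le> d then bot else p)"
  proof (cases "p \<le> d")
    case True
    moreover have "?q \<le> d" "?r \<le> d"
      using True split_parts(2)[of e p] by (metis le_sup_iff)+
    ultimately show ?thesis
      by (simp add: le_supI1)
  next
    case False
    then have "inf d ?q = bot" "inf (sup d ?q) ?r = bot"
      using Cons.prems disjoint_split_parts[of d p e] by auto
    then have "(if ?q \<le> d then bot else ?q) = ?q" "(if ?r \<le> sup d ?q then bot else ?r) = ?r"
      by (metis inf.absorb2)+
    then show ?thesis
      using False by (simp only: split_parts if_False)
  qed
  ultimately show ?case
    by (simp only: split.simps greedy.simps sup.assoc[symmetric])
qed simp

section \<open>The limit along an enumeration of the lattice\<close>

primrec stage :: "(nat \<Rightarrow> 'a::complemented_modular_lattice) \<Rightarrow> nat \<Rightarrow> 'a list" where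
  "stage a 0 = [top]"
| "stage a (Suc n) = split (a n) (stage a n)"

lemma independent_stage: "independent bot (stage a n)"
  by (induction n) (simp_all add: independent_split)

lemma join_stage: "join (stage a n) = top"
  by (induction n) (simp_all add: join_split)

lemma adapted_stage_mono:
  assumes "m \<le> n" "adapted x (stage a m)"
  shows "adapted x (stage a n) \<and> greedy x (stage a n) = greedy x (stage a m)"
  using assms by (induction n rule: dec_induct) (simp_all add: adapted_split_stable greedy_split)

theorem theorem4p1:
  assumes "countable (UNIV :: 'a::complemented_modular_lattice set)"
  shows "\<exists>f :: 'a \<Rightarrow> 'a. banaschewski_function f \<and> boolean_sublattice (range f)"
proof -
  define ps where "ps = stage (from_nat_into (UNIV :: 'a set))"
  \<comment> \<open>The element with number \<open>k\<close> is treated in the passage from stage \<open>k\<close> to stage \<open>k + 1\<close>.\<close>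
  define t where "t x = Suc (to_nat_on UNIV x)" for x :: 'a
  define f where "f x = greedy x (ps (t x))" for x
  have "adapted x (ps (t x))" for x
    unfolding ps_def t_def by (simp add: assms adapted_split)
  then have late: "adapted x (ps n)" "greedy x (ps n) = f x" if "t x \<le> n" for x n
    using adapted_stage_mono[OF that] unfolding f_def ps_def by blast+
  have any: "greedy x (ps n) = f x" if "adapted x (ps n)" for x n
    using adapted_stage_mono[of n "max n (t x)" x] late(2)[of x "max n (t x)"] that
    unfolding ps_def by simp
  have "antimono f"
  proof (rule antimonoI)
    fix x y :: 'a assume "x \<le> y"
    then show "f y \<le> f x"
      using greedy_antimono[of x y "ps (max (t x) (t y))"] by (simp add: late(2))
  qed
  moreover have "disjoint_sup x (f x) top" for x
    using inf_greedy[OF late(1)[of x "t x"]] sup_greedy[of x "ps (t x)"]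
    by (simp add: disjoint_sup_def f_def ps_def join_stage)
  ultimately have "banaschewski_function f"
    by (simp add: banaschewski_function_def)
  moreover have "boolean_sublattice (range f)"
  proof (rule boolean_sublattice_locally)
    fix u v w assume "u \<in> range f" "v \<in> range f" "w \<in> range f"
    then obtain x y z where xyz: "u = f x" "v = f y" "w = f z"
      by blast
    define n where "n = max (t x) (max (t y) (t z))"
    have "f x \<in> block_joins (ps n)" "f y \<in> block_joins (ps n)" "f z \<in> block_joins (ps n)"
      using greedy_in_block_joins[of _ "ps n"] late(2)[of _ n]
      unfolding n_def by (metis max.cobounded1 max.cobounded2 max.coboundedI2)+
    moreover have "block_joins (ps n) \<subseteq> range f"
    proof
      fix b assume "b \<in> block_joins (ps n)"
      then obtain P where b: "b = join (filter P (ps n))"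
        unfolding block_joins_def by blast
      let ?x = "join (filter (\<lambda>p. \<not> P p) (ps n))"
      have "adapted ?x (ps n)" "greedy ?x (ps n) = b"
        using greedy_block_join[OF independent_stage, of ?x P "from_nat_into UNIV" n] b
        by (simp_all add: ps_def)
      then show "b \<in> range f"
        using any by blast
    qed
    moreover have "boolean_sublattice (block_joins (ps n))"
      unfolding ps_def by (intro boolean_sublattice_block_joins independent_stage)
    moreover have "bot \<in> block_joins (ps n)" "top \<in> block_joins (ps n)"
      using bot_in_block_joins join_in_block_joins[of "ps n"] by (auto simp: ps_def join_stage)
    ultimately show "\<exists>B\<subseteq>range f. boolean_sublattice B \<and> {u, v, w, bot, top} \<subseteq> B"
      using xyz by (intro exI[of _ "block_joins (ps n)"]) simp
  qed simp
  ultimately show ?thesis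
    by blast
qed

end
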